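(* Let $q_{n,\mathbf{m}} := \frac{\prod_{i=1}^n m_i}{\max_{i} m_i}$. Then $$\lim_{q_{n,\mathbf{m}}\to\infty}\Pr\left[\text{the clockwork best-response dynamic on } G_{n,\mathbf{m}} \text{ converges to a PNE}\right]=0,$$ i.e. for every $\varepsilon>0$ there is $Q$ such that for all $n\ge 2$ and all $\mathbf{m}=(m_1,\dots,m_n)$ with $m_i\ge 2$ and $q_{n,\mathbf{m}}\ge Q$, this probability is less than $\varepsilon$.
   Context: A random game $G_{n,\mathbf{m}}$ has $n\ge 2$ players; player $i$ has action set $[m_i]=\{1,\dots,m_i\}$ with $m_i\ge 2$; $\mathcal{M}=\times_{i=1}^n[m_i]$. For each player $i$ and profile $\mathbf{a}\in\mathcal{M}$ the payoff $U_i(\mathbf{a})$ is drawn from a fixed atomless probability distribution on $\mathbb{R}$, independently across all $i$ and $\mathbf{a}$. For an environment $\mathbf{a}_{-i}\in\times_{j\neq i}[m_j]$, the best response $B_i(\mathbf{a}_{-i})=\arg\max_{x\in[m_i]}U_i(x,\mathbf{a}_{-i})$ is almost surely unique. A pure Nash equilibrium (PNE) is a profile $\mathbf{a}$ with $a_i=B_i(\mathbf{a}_{-i})$ for all $i$. The clockwork playing sequence is $s_{\texttt{c}}(t)=1+((t-1)\bmod n)$, $t\in\mathbb{N}=\{1,2,\dots\}$. The clockwork best-response dynamic: draw $\mathbf{A}^0$ uniformly from $\mathcal{M}$ (independently of payoffs); for each $t\ge1$, with $i=s_{\texttt{c}}(t)$, set $A^t_j=A^{t-1}_j$ for $j\ne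 i$ and $A^t_i=B_i(\mathbf{A}^{t-1}_{-i})$. The dynamic converges to a PNE if there is a finite $t\ge 1$ such that $\mathbf{A}^t$ is a PNE of $G_{n,\mathbf{m}}$. *)

theory Defs
  imports "HOL-Probability.Probability"
begin

definition profiles :: "nat \<Rightarrow> (nat \<Rightarrow> nat) \<Rightarrow> (nat \<Rightarrow> nat) set" where
  "profiles n m = PiE {1..n} (\<lambda>i. {1..m i})"

definition payoff_index :: "nat \<Rightarrow> (nat \<Rightarrow> nat) \<Rightarrow> (nat \<times> (nat \<Rightarrow> nat)) set" where
  "payoff_index n m = {1..n} \<times> profiles n m"

text \<open>Best response of player i to the environment of profile a (only a restricted
  to players other than i matters). Ties (a null event) are broken by the least index.\<close>
definition best_resp ::
  "(nat \<Rightarrow> nat) \<Rightarrow> (nat \<times> (nat \<Rightarrow> nat) \<Rightarrow> real) \<Rightarrow> nat \<Rightarrow> (nat \<Rightarrow> nat) \<Rightarrow> nat" where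
  "best_resp m U i a =
     (LEAST x. x \<in> {1..m i} \<and> (\<forall>y\<in>{1..m i}. U (i, a(i := y)) \<le> U (i, a(i := x))))"

definition is_PNE ::
  "nat \<Rightarrow> (nat \<Rightarrow> nat) \<Rightarrow> (nat \<times> (nat \<Rightarrow> nat) \<Rightarrow> real) \<Rightarrow> (nat \<Rightarrow> nat) \<Rightarrow> bool" where
  "is_PNE n m U a \<longleftrightarrow> a \<in> profiles n m \<and> (\<forall>i\<in>{1..n}. a i = best_resp m U i a)"

definition clockwork :: "nat \<Rightarrow> nat \<Rightarrow> nat" where
  "clockwork n t = 1 + ((t - 1) mod n)"

primrec clock_dyn ::
  "nat \<Rightarrow> (nat \<Rightarrow> nat) \<Rightarrow> (nat \<times> (nat \<Rightarrow> nat) \<Rightarrow> real) \<Rightarrow> (nat \<Rightarrow> nat) \<Rightarrow> nat \<Rightarrow> (nat \<Rightarrow> nat)" where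
  "clock_dyn n m U a0 0 = a0"
| "clock_dyn n m U a0 (Suc t) =
     (let A = clock_dyn n m U a0 t; i = clockwork n (Suc t) in A(i := best_resp m U i A))"

definition converges_PNE ::
  "nat \<Rightarrow> (nat \<Rightarrow> nat) \<Rightarrow> (nat \<times> (nat \<Rightarrow> nat) \<Rightarrow> real) \<Rightarrow> (nat \<Rightarrow> nat) \<Rightarrow> bool" where
  "converges_PNE n m U a0 \<longleftrightarrow> (\<exists>t\<ge>1. is_PNE n m U (clock_dyn n m U a0 t))"

definition game_space ::
  "nat \<Rightarrow> (nat \<Rightarrow> nat) \<Rightarrow> real measure \<Rightarrow> ((nat \<times> (nat \<Rightarrow> nat) \<Rightarrow> real) \<times> (nat \<Rightarrow> nat)) measure" where
  "game_space n m D = PiM (payoff_index n m) (\<lambda>_. D) \<Otimes>\<^sub>M measure_pmf (pmf_of_set (profiles n m))"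

definition conv_event ::
  "nat \<Rightarrow> (nat \<Rightarrow> nat) \<Rightarrow> real measure \<Rightarrow> ((nat \<times> (nat \<Rightarrow> nat) \<Rightarrow> real) \<times> (nat \<Rightarrow> nat)) set" where
  "conv_event n m D = {\<omega> \<in> space (game_space n m D). converges_PNE n m (fst \<omega>) (snd \<omega>)}"

definition q_nm :: "nat \<Rightarrow> (nat \<Rightarrow> nat) \<Rightarrow> real" where
  "q_nm n m = (\<Prod>i\<in>{1..n}. real (m i)) / real (Max (m ` {1..n}))"

end

theory Submission
  imports Defs "HOL-Real_Asymp.Real_Asymp"
begin

text \<open>
  Call a pair of a player and an environment a cell. As long as no cell is visited twice, the best
  responses met by the dynamic are independent and uniform, so a set of initial trajectories without
  repeated cells is at most as likely as under uniform draws. If a PNE is first reached at time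
  \<open>t\<close>, then no cell is repeated before step \<open>t + n - 1\<close> (a repetition makes the
  trajectory periodic, so the PNE would have been reached earlier), and the \<open>n - 1\<close> draws that
  follow \<open>t\<close> are forced; this has probability at most \<open>1 / q\<close>. On the other hand, the
  environments met by a player with the largest number of actions are refreshed completely in every
  round, so the absence of repetitions during \<open>k\<close> rounds is a birthday event among \<open>q\<close>
  environments, of probability at most \<open>exp (- k\<^sup>2 / (2 q))\<close>. Since \<open>n \<le> 1 + log 2 q\<close>,
  the choice \<open>k \<approx> q powr (2/3)\<close> makes both \<open>n (k + 1) / q\<close> and the birthday bound vanish.
\<close>

section \<open>Cells, environments and best responses\<close>

text \<open>The action of player \<open>i\<close> is overwritten by the non-action 0, so that a cell remembers
  only the environment of \<open>i\<close>.\<close>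
definition cell :: "nat \<Rightarrow> (nat \<Rightarrow> nat) \<Rightarrow> nat \<times> (nat \<Rightarrow> nat)" where
  "cell i a = (i, a(i := 0))"

text \<open>Inside each cell the values of \<open>v\<close> and \<open>w\<close> trade places. A
  transposition is its own inverse, so this is an involution of the payoff indices turning the
  maximiser \<open>v\<close> into \<open>w\<close>.\<close>

definition swap_actions ::
  "(nat \<times> (nat \<Rightarrow> nat) \<Rightarrow> nat) \<Rightarrow> (nat \<times> (nat \<Rightarrow> nat) \<Rightarrow> nat) \<Rightarrow>
     nat \<times> (nat \<Rightarrow> nat) \<Rightarrow> nat \<times> (nat \<Rightarrow> nat)" where
  "swap_actions v w = (\<lambda>(i, a).
     (i, a(i := Transposition.transpose (v (cell i a)) (w (cell i a)) (a i))))"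

lemma cell_fun_upd [simp]: "cell i (a(i := x)) = cell i a"
  by (simp add: cell_def)

lemma best_resp_fun_upd [simp]: "best_resp m U i (a(i := x)) = best_resp m U i a"
  by (simp add: best_resp_def)

text \<open>The mover overwrites the only coordinate the environment omits, so equal cells lead to
  equal full profiles. Periodicity of the dynamic rests on this.\<close>

lemma best_resp_cell_eq:
  assumes "cell i a = cell j b"
  shows "best_resp m U i a = best_resp m U j b"
    and "a(i := best_resp m U i a) = b(j := best_resp m U j b)"
proof -
  have ij: "i = j" and ab: "a(i := 0) = b(i := 0)"
    using assms by (auto simp: cell_def)
  have eq: "a(i := x) = b(i := x)" for x
    using arg_cong[OF ab, of "\<lambda>f. f(i := x)"] by simp
  show br: "best_resp m U i a = best_resp m U j b"
    using best_resp_fun_upd[of m U i a 0] best_resp_fun_upd[of m U i b 0] ij ab by metis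
  show "a(i := best_resp m U i a) = b(j := best_resp m U j b)"
    using br eq ij by simp
qed

lemma
  assumes "1 \<le> m i"
  shows best_resp_in: "best_resp m U i a \<in> {1..m i}"
    and best_resp_max: "y \<in> {1..m i} \<Longrightarrow> U (i, a(i := y)) \<le> U (i, a(i := best_resp m U i a))"
proof -
  have "Max ((\<lambda>x. U (i, a(i := x))) ` {1..m i}) \<in> (\<lambda>x. U (i, a(i := x))) ` {1..m i}"
    using assms by (intro Max_in) auto
  then obtain x where x: "x \<in> {1..m i}"
    "U (i, a(i := x)) = Max ((\<lambda>x. U (i, a(i := x))) ` {1..m i})" by force
  have "\<exists>x. x \<in> {1..m i} \<and> (\<forall>y\<in>{1..m i}. U (i, a(i := y)) \<le> U (i, a(i := x)))"
    using x by (intro exI[of _ x]) auto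
  from LeastI_ex[OF this]
  show "best_resp m U i a \<in> {1..m i}"
    and "y \<in> {1..m i} \<Longrightarrow> U (i, a(i := y)) \<le> U (i, a(i := best_resp m U i a))"
    by (auto simp: best_resp_def)
qed

lemma swap_actions_involutory [simp]: "swap_actions v w (swap_actions v w z) = z"
  by (cases z) (simp add: swap_actions_def)

lemma fun_upd_in_profiles:
  assumes "a \<in> profiles n m" "i \<in> {1..n}" "x \<in> {1..m i}"
  shows "a(i := x) \<in> profiles n m"
  using assms unfolding profiles_def by (auto simp: PiE_iff extensional_def)

lemma finite_profiles [simp]: "finite (profiles n m)"
  by (auto simp: profiles_def intro: finite_PiE)

lemma finite_payoff_index [simp]: "finite (payoff_index n m)"
  by (simp add: payoff_index_def)

lemma card_profiles: "card (profiles n m) = (\<Prod>i\<in>{1..n}. m i)"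
  by (simp add: profiles_def card_PiE)

section \<open>The payoff space: measurability and absence of ties\<close>

locale random_game =
  fixes n :: nat and m :: "nat \<Rightarrow> nat" and D :: "real measure"
  assumes n_ge: "2 \<le> n"
    and m_ge: "\<And>i. i \<in> {1..n} \<Longrightarrow> 2 \<le> m i"
    and prob_D: "prob_space D"
    and sets_D: "sets D = sets borel"
    and atomless: "\<And>x. emeasure D {x} = 0"
begin

abbreviation payoffs :: "(nat \<times> (nat \<Rightarrow> nat) \<Rightarrow> real) measure" where
  "payoffs \<equiv> PiM (payoff_index n m) (\<lambda>_. D)"

definition cells :: "(nat \<times> (nat \<Rightarrow> nat)) set" where
  "cells = (\<Union>i\<in>{1..n}. cell i ` profiles n m)"

lemma m_pos: "i \<in> {1..n} \<Longrightarrow> 1 \<le> m i"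
  using m_ge[of i] by simp

sublocale payoffs: prob_space payoffs
  by (intro prob_space_PiM prob_D)

text \<open>Covers every index \<open>z\<close>, so that automation meets no side condition: outside
  \<open>payoff_index n m\<close> the coordinate is constantly \<open>undefined\<close>.\<close>

lemma measurable_payoff [measurable]: "(\<lambda>U. U z) \<in> borel_measurable payoffs"
proof (cases "z \<in> payoff_index n m")
  case True
  then have "(\<lambda>U. U z) \<in> payoffs \<rightarrow>\<^sub>M D" by measurable
  then show ?thesis using measurable_cong_sets[OF refl sets_D] by blast
next
  case False
  then have "U z = undefined" if "U \<in> space payoffs" for U
    using PiE_arb[of U "payoff_index n m" _ z] that by (simp add: space_PiM)
  then show ?thesis
    using measurable_cong[of payoffs "\<lambda>U. U z" "\<lambda>_. undefined" borel] by simp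
qed

lemma pred_payoff_le [measurable]: "Measurable.pred payoffs (\<lambda>U. U z \<le> U z')"
  unfolding pred_def by (rule borel_measurable_le[OF measurable_payoff measurable_payoff])

lemma pred_payoff_less [measurable]: "Measurable.pred payoffs (\<lambda>U. U z < U z')"
  unfolding pred_def by (rule borel_measurable_less[OF measurable_payoff measurable_payoff])

lemma pred_best_resp [measurable]: "Measurable.pred payoffs (\<lambda>U. best_resp m U i a = x)"
  unfolding best_resp_def by measurable

lemma AE_payoff_neq:
  assumes z: "z \<in> payoff_index n m" "z' \<in> payoff_index n m" "z \<noteq> z'"
  shows "AE U in payoffs. U z \<noteq> U z'"
proof -
  interpret product_prob_space "\<lambda>_. D" "payoff_index n m"
    using prob_D by (simp add: product_prob_space_def product_prob_space_axioms_def
        product_sigma_finite_def prob_space_imp_sigma_finite)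
  let ?I = "payoff_index n m - {z}"
  have I: "insert z ?I = payoff_index n m" using z by auto
  have [measurable]: "{U \<in> space payoffs. U z = U z'} \<in> sets payoffs" by measurable
  have "emeasure payoffs {U \<in> space payoffs. U z = U z'} =
     (\<integral>\<^sup>+ U. indicator {U \<in> space payoffs. U z = U z'} U \<partial>PiM (insert z ?I) (\<lambda>_. D))"
    unfolding I by (subst nn_integral_indicator) auto
  also have "\<dots> = (\<integral>\<^sup>+ U. (\<integral>\<^sup>+ y. indicator {U \<in> space payoffs. U z = U z'} (U(z := y)) \<partial>D) \<partial>PiM ?I (\<lambda>_. D))"
    by (rule product_nn_integral_insert) (simp_all only: I finite_Diff finite_payoff_index, auto)
  \<comment> \<open>With all other coordinates fixed, a tie forces coordinate \<open>z\<close> to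
    hit the single point \<open>U z'\<close>, which is null for an atomless law.\<close>
  also have "\<dots> \<le> (\<integral>\<^sup>+ U. (\<integral>\<^sup>+ y. indicator {U z'} y \<partial>D) \<partial>PiM ?I (\<lambda>_. D))"
    using z(3) by (intro nn_integral_mono) (auto simp: indicator_def)
  also have "\<dots> = 0"
    using atomless by (simp add: sets_D)
  finally show ?thesis
    by (subst AE_iff_measurable[OF _ refl]) auto
qed

lemma AE_no_ties:
  "AE U in payoffs. \<forall>z\<in>payoff_index n m. \<forall>z'\<in>payoff_index n m. z \<noteq> z' \<longrightarrow> U z \<noteq> U z'"
  using AE_payoff_neq by (intro AE_finite_allI) (auto intro!: AE_impI)

section \<open>Probability of a prescribed table of best responses\<close>

lemma finite_cells: "finite cells"
  by (simp add: cells_def)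

lemma cells_payoff_index:
  assumes "(i, e) \<in> cells" "x \<in> {1..m i}"
  shows "(i, e(i := x)) \<in> payoff_index n m"
  using assms fun_upd_in_profiles[of _ n m i x] by (auto simp: cells_def cell_def payoff_index_def)

lemma cell_idem: "(i, e) \<in> cells \<Longrightarrow> cell i e = (i, e)"
  by (auto simp: cells_def cell_def)

text \<open>Strictness removes the tie-breaking by least index, which relabelling actions would not
  respect.\<close>

definition strict_best :: "(nat \<times> (nat \<Rightarrow> nat)) set \<Rightarrow> (nat \<times> (nat \<Rightarrow> nat) \<Rightarrow> nat) \<Rightarrow>
    (nat \<times> (nat \<Rightarrow> nat) \<Rightarrow> real) set" where
  "strict_best C v = {U \<in> space payoffs. \<forall>(i, e)\<in>C. \<forall>y\<in>{1..m i}.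
     y \<noteq> v (i, e) \<longrightarrow> U (i, e(i := y)) < U (i, e(i := v (i, e)))}"

lemma strict_bestD:
  "U \<in> strict_best C v \<Longrightarrow> (i, e) \<in> C \<Longrightarrow> y \<in> {1..m i} \<Longrightarrow> y \<noteq> v (i, e) \<Longrightarrow>
     U (i, e(i := y)) < U (i, e(i := v (i, e)))"
  by (auto simp: strict_best_def)

lemma sets_strict_best [measurable]: "finite C \<Longrightarrow> strict_best C v \<in> sets payoffs"
proof -
  assume "finite C"
  then have [measurable]: "Measurable.pred payoffs (\<lambda>U. \<forall>c\<in>C. \<forall>y\<in>{1..m (fst c)}. y \<noteq> v c \<longrightarrow>
      U (fst c, (snd c)(fst c := y)) < U (fst c, (snd c)(fst c := v c)))"
    by (intro pred_intros_finite) measurable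
  show ?thesis unfolding strict_best_def case_prod_beta prod.collapse by measurable
qed

lemma swap_actions_payoff_index:
  assumes "v \<in> PiE C (\<lambda>c. {1..m (fst c)})" "w \<in> PiE C (\<lambda>c. {1..m (fst c)})"
    and "z \<in> payoff_index n m"
  shows "swap_actions v w z \<in> payoff_index n m"
proof -
  obtain i a where z: "z = (i, a)" "i \<in> {1..n}" "a \<in> profiles n m"
    using assms(3) by (auto simp: payoff_index_def)
  have "a i \<in> {1..m i}" using z by (auto simp: profiles_def)
  \<comment> \<open>Off \<open>C\<close> both tables take the default \<open>undefined\<close>,
    possibly not an action, but then the transposition is the identity.\<close>
  moreover have "v (cell i a) \<in> {1..m i} \<and> w (cell i a) \<in> {1..m i} \<or> v (cell i a) = w (cell i a)"
  proof (cases "cell i a \<in> C")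
    case True
    then show ?thesis using assms(1,2) by (auto simp: PiE_iff cell_def)
  next
    case False
    then show ?thesis using assms(1,2) PiE_arb by metis
  qed
  ultimately have "Transposition.transpose (v (cell i a)) (w (cell i a)) (a i) \<in> {1..m i}"
    by (auto simp: Transposition.transpose_def)
  then show ?thesis
    using z by (auto simp: swap_actions_def payoff_index_def intro!: fun_upd_in_profiles)
qed

text \<open>Permuting the payoffs inside each cell preserves the product measure. Together with
  disjointness, this bounds the probability of every strict best-response table without an
  independence computation.\<close>
lemma strict_best_symmetric:
  assumes C: "C \<subseteq> cells"
    and v: "v \<in> PiE C (\<lambda>c. {1..m (fst c)})" and w: "w \<in> PiE C (\<lambda>c. {1..m (fst c)})"
  shows "measure payoffs (strict_best C v) \<le> measure payoffs (strict_best C w)"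
proof -
  let ?f = "\<lambda>U. \<lambda>z\<in>payoff_index n m. U (swap_actions v w z)"
  have fin: "finite C" using C finite_cells finite_subset by blast
  have "inj_on (swap_actions v w) (payoff_index n m)"
    by (metis inj_onI swap_actions_involutory)
  moreover have "swap_actions v w \<in> payoff_index n m \<rightarrow> payoff_index n m"
    using swap_actions_payoff_index[OF v w] by auto
  ultimately have distr: "distr payoffs payoffs ?f = payoffs"
    using distr_PiM_reindex[of "payoff_index n m" "\<lambda>_. D" "swap_actions v w" "payoff_index n m"] prob_D
    by simp
  have meas: "?f \<in> payoffs \<rightarrow>\<^sub>M payoffs"
  proof (rule measurable_restrict)
    fix z
    show "(\<lambda>U. U (swap_actions v w z)) \<in> payoffs \<rightarrow>\<^sub>M D"
      using measurable_payoff measurable_cong_sets[OF refl sets_D] by blast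
  qed
  have sub: "strict_best C v \<subseteq> ?f -` strict_best C w \<inter> space payoffs"
  proof
    fix U assume U: "U \<in> strict_best C v"
    then have sp: "U \<in> space payoffs" by (simp add: strict_best_def)
    have "?f U (i, e(i := y)) < ?f U (i, e(i := w (i, e)))"
      if c: "(i, e) \<in> C" "y \<in> {1..m i}" "y \<noteq> w (i, e)" for i e y
    proof -
      have ce: "(i, e) \<in> cells" using c C by auto
      have vw: "v (i, e) \<in> {1..m i}" "w (i, e) \<in> {1..m i}"
        using v w c by (auto simp: PiE_iff)
      \<comment> \<open>\<open>?f U\<close> at action \<open>y\<close> reads \<open>U\<close> at
        \<open>?y\<close>; since \<open>w\<close> is read at \<open>v\<close>, a strict maximum of
        \<open>U\<close> at \<open>v\<close> becomes one of \<open>?f U\<close> at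
        \<open>w\<close>.\<close>
      let ?y = "Transposition.transpose (v (i, e)) (w (i, e)) y"
      have y: "?y \<in> {1..m i}" "?y \<noteq> v (i, e)"
        using c vw by (auto simp: Transposition.transpose_def)
      have "U (i, e(i := ?y)) < U (i, e(i := v (i, e)))"
        using U c(1) y unfolding strict_best_def by blast
      then show ?thesis
        using cells_payoff_index[OF ce] c(2) vw
        by (simp add: swap_actions_def cell_idem[OF ce])
    qed
    moreover have "?f U \<in> space payoffs" using meas sp by (auto dest: measurable_space)
    ultimately show "U \<in> ?f -` strict_best C w \<inter> space payoffs"
      using sp unfolding strict_best_def by blast
  qed
  have "measure payoffs (strict_best C v) \<le> measure payoffs (?f -` strict_best C w \<inter> space payoffs)"
    using sub meas fin by (intro payoffs.finite_measure_mono) (auto intro: measurable_sets)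
  also have "\<dots> = measure (distr payoffs payoffs ?f) (strict_best C w)"
    using meas fin by (simp add: measure_distr)
  finally show ?thesis unfolding distr .
qed

lemma disjoint_strict_best:
  "disjoint_family_on (strict_best C) (PiE C (\<lambda>c. {1..m (fst c)}))"
unfolding disjoint_family_on_def
proof (intro ballI impI)
  fix v w assume v: "v \<in> PiE C (\<lambda>c. {1..m (fst c)})" and w: "w \<in> PiE C (\<lambda>c. {1..m (fst c)})"
    and ne: "v \<noteq> w"
  obtain c where c: "c \<in> C" "v c \<noteq> w c"
    using PiE_ext[OF v w] ne by auto
  obtain i e where ie: "c = (i, e)" by fastforce
  have "v c \<in> {1..m i}" "w c \<in> {1..m i}" using v w c ie by (auto simp: PiE_iff)
  then have "U (i, e(i := w c)) < U (i, e(i := v c)) \<and> U (i, e(i := v c)) < U (i, e(i := w c))"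
    if "U \<in> strict_best C v" "U \<in> strict_best C w" for U
    using strict_bestD[OF that(1), of i e "w c"] strict_bestD[OF that(2), of i e "v c"] c
    unfolding ie by auto
  then show "strict_best C v \<inter> strict_best C w = {}"
    by (meson disjoint_iff order_less_asym)
qed

text \<open>The events of all tables on \<open>C\<close> are disjoint and, by symmetry, none is less
  likely than that of \<open>v\<close>; their number is the product on the right.\<close>

lemma measure_strict_best_le:
  assumes C: "C \<subseteq> cells" and v: "v \<in> PiE C (\<lambda>c. {1..m (fst c)})"
  shows "measure payoffs (strict_best C v) \<le> 1 / (\<Prod>c\<in>C. real (m (fst c)))"
proof -
  let ?V = "PiE C (\<lambda>c. {1..m (fst c)})"
  have fin: "finite C" using C finite_cells finite_subset by blast
  then have finV: "finite ?V" by (intro finite_PiE) auto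
  have card: "real (card ?V) = (\<Prod>c\<in>C. real (m (fst c)))"
    using fin by (simp add: card_PiE)
  have pos: "0 < card ?V" using finV v by (auto simp: card_gt_0_iff)
  have "real (card ?V) * measure payoffs (strict_best C v) \<le> (\<Sum>w\<in>?V. measure payoffs (strict_best C w))"
    using strict_best_symmetric[OF C v] by (intro sum_bounded_below) auto
  also have "\<dots> = measure payoffs (\<Union>w\<in>?V. strict_best C w)"
    using finV disjoint_strict_best fin
    by (intro payoffs.finite_measure_finite_Union[symmetric]) auto
  also have "\<dots> \<le> 1" by (rule payoffs.prob_le_1)
  finally show ?thesis using pos unfolding card[symmetric] by (simp add: field_simps)
qed

text \<open>Off the null set of ties, a best response is a strict maximum.\<close>

lemma prob_best_resp_le:
  assumes C: "C \<subseteq> cells" and v: "v \<in> PiE C (\<lambda>c. {1..m (fst c)})"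
  shows "measure payoffs {U \<in> space payoffs. \<forall>c\<in>C. best_resp m U (fst c) (snd c) = v c}
     \<le> 1 / (\<Prod>c\<in>C. real (m (fst c)))"
proof -
  have fin: "finite C" using C finite_cells finite_subset by blast
  have "AE U in payoffs. U \<in> {U \<in> space payoffs. \<forall>c\<in>C. best_resp m U (fst c) (snd c) = v c}
      \<longrightarrow> U \<in> strict_best C v"
    using AE_no_ties
  proof eventually_elim
    case (elim U)
    show ?case
    proof
      assume U: "U \<in> {U \<in> space payoffs. \<forall>c\<in>C. best_resp m U (fst c) (snd c) = v c}"
      have "U (i, e(i := y)) < U (i, e(i := v (i, e)))"
        if c: "(i, e) \<in> C" "y \<in> {1..m i}" "y \<noteq> v (i, e)" for i e y
      proof -
        have ce: "(i, e) \<in> cells" using c C by auto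
        have "i \<in> {1..n}" using ce by (auto simp: cells_def cell_def)
        then have "U (i, e(i := y)) \<le> U (i, e(i := v (i, e)))"
          using best_resp_max[of m i y U e] m_pos[of i] c U by force
        moreover have "v (i, e) \<in> {1..m i}" using v c by (auto simp: PiE_iff)
        then have "U (i, e(i := y)) \<noteq> U (i, e(i := v (i, e)))"
          using elim cells_payoff_index[OF ce] c(2,3) by (metis fun_upd_same snd_conv)
        ultimately show ?thesis by simp
      qed
      then show "U \<in> strict_best C v" using U unfolding strict_best_def by blast
    qed
  qed
  then have "measure payoffs {U \<in> space payoffs. \<forall>c\<in>C. best_resp m U (fst c) (snd c) = v c}
     \<le> measure payoffs (strict_best C v)"
    using fin by (intro payoffs.finite_measure_mono_AE) auto
  also note measure_strict_best_le[OF C v]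
  finally show ?thesis .
qed

section \<open>Movers, and trajectories driven by sequences of draws\<close>

text \<open>The steps of the dynamic are numbered from 0 here: step \<open>t\<close> leads from the profile at time
  \<open>t\<close> to the one at time \<open>Suc t\<close>.\<close>
abbreviation mover :: "nat \<Rightarrow> nat" where
  "mover t \<equiv> clockwork n (Suc t)"

lemma mover_in: "mover t \<in> {1..n}"
  using n_ge by (simp add: clockwork_def Suc_le_eq)

lemma mover_m_pos: "1 \<le> m (mover t)"
  by (rule m_pos[OF mover_in])

lemma mover_eq_iff: "mover s = mover t \<longleftrightarrow> s mod n = t mod n"
  by (simp add: clockwork_def)

lemma mover_neq:
  assumes "s < t" "t < s + n"
  shows "mover s \<noteq> mover t"
proof
  assume "mover s = mover t"
  then have "n dvd t - s"
    using assms by (metis mover_eq_iff mod_eq_dvd_iff_nat less_imp_le)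
  then show False using assms by (auto dest: dvd_imp_le)
qed

lemma mover_eq_imp_le: "mover s = mover t \<Longrightarrow> s < t \<Longrightarrow> s + n \<le> t"
  using mover_neq[of s t] by linarith

text \<open>Any \<open>n\<close> consecutive movers are distinct, hence every player moves exactly
  once among them.\<close>

lemma prod_mover: "(\<Prod>s\<in>{t..<t + n}. f (mover s)) = (\<Prod>i\<in>{1..n}. f i)"
proof -
  have inj: "inj_on mover {t..<t + n}"
  proof (rule linorder_inj_onI)
    fix r s assume "r < s" "r \<in> {t..<t + n}" "s \<in> {t..<t + n}"
    then show "mover r \<noteq> mover s" by (intro mover_neq) auto
  qed auto
  have "mover ` {t..<t + n} = {1..n}"
    by (rule card_subset_eq) (use mover_in card_image[OF inj] in auto)
  then show ?thesis using prod.reindex[OF inj, of f] by simp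
qed

text \<open>The dynamic with its best responses replaced by an arbitrary sequence \<open>x\<close>.
  This separates counting sequences from the randomness of the payoffs.\<close>

primrec play :: "(nat \<Rightarrow> nat) \<Rightarrow> (nat \<Rightarrow> nat) \<Rightarrow> nat \<Rightarrow> (nat \<Rightarrow> nat)" where
  "play a0 x 0 = a0"
| "play a0 x (Suc t) = (play a0 x t)(mover t := x t)"

definition visit :: "(nat \<Rightarrow> nat) \<Rightarrow> (nat \<Rightarrow> nat) \<Rightarrow> nat \<Rightarrow> nat \<times> (nat \<Rightarrow> nat)" where
  "visit a0 x t = cell (mover t) (play a0 x t)"

definition seqs :: "nat \<Rightarrow> (nat \<Rightarrow> nat) set" where
  "seqs T = PiE {..<T} (\<lambda>t. {1..m (mover t)})"

definition draws :: "(nat \<times> (nat \<Rightarrow> nat) \<Rightarrow> real) \<Rightarrow> (nat \<Rightarrow> nat) \<Rightarrow> nat \<Rightarrow> nat" where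
  "draws U a0 t = best_resp m U (mover t) (clock_dyn n m U a0 t)"

lemma clock_dyn_eq_play: "clock_dyn n m U a0 t = play a0 (draws U a0) t"
  by (induction t) (simp_all add: draws_def Let_def)

lemma draws_in: "draws U a0 t \<in> {1..m (mover t)}"
  unfolding draws_def by (rule best_resp_in[of m, OF mover_m_pos])

lemma play_cong: "(\<And>s. s < t \<Longrightarrow> x s = y s) \<Longrightarrow> play a0 x t = play a0 y t"
  by (induction t) auto

lemma visit_cong: "(\<And>s. s < t \<Longrightarrow> x s = y s) \<Longrightarrow> visit a0 x t = visit a0 y t"
  unfolding visit_def using play_cong by metis

lemma play_in_profiles:
  "a0 \<in> profiles n m \<Longrightarrow> (\<And>s. s < t \<Longrightarrow> x s \<in> {1..m (mover s)}) \<Longrightarrow> play a0 x t \<in> profiles n m"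
proof (induction t)
  case (Suc t)
  have "play a0 x t \<in> profiles n m" using Suc by simp
  then show ?case using fun_upd_in_profiles[of _ n m "mover t" "x t"] mover_in Suc.prems(2)[of t]
    by (simp only: play.simps lessI)
qed simp

text \<open>A drawn action stands until its player moves again \<open>n\<close> steps later, so a
  profile records the last \<open>n\<close> draws.\<close>

lemma play_last_draw: "t < s \<Longrightarrow> s \<le> t + n \<Longrightarrow> play a0 x s (mover t) = x t"
proof (induction s)
  case (Suc s)
  show ?case
  proof (cases "s = t")
    case False
    then have "mover t \<noteq> mover s" using Suc.prems by (intro mover_neq) auto
    then show ?thesis using Suc False by simp
  qed simp
qed simp

lemma finite_seqs: "finite (seqs T)"
  by (auto simp: seqs_def intro: finite_PiE)

lemma restrict_in_seqs: "y \<in> seqs T \<Longrightarrow> t \<le> T \<Longrightarrow> restrict y {..<t} \<in> seqs t"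
  unfolding seqs_def by (rule PiE_I) (auto simp: PiE_iff)

lemma card_seqs: "card (seqs T) = (\<Prod>t<T. m (mover t))"
  by (simp add: seqs_def card_PiE)

lemma card_seqs_pos: "0 < card (seqs T)"
  unfolding card_seqs using mover_m_pos by (intro prod_pos) (auto simp: Suc_le_eq)

lemma visit_in_cells:
  assumes "a0 \<in> profiles n m" "\<And>s. s < t \<Longrightarrow> x s \<in> {1..m (mover s)}"
  shows "visit a0 x t \<in> cells"
  unfolding visit_def cells_def using play_in_profiles[of a0 t x] assms mover_in by blast

text \<open>The comparison with uniform draws: following a fixed \<open>y\<close> without repeated
  cells prescribes best responses in \<open>T\<close> distinct cells, which has probability at most
  \<open>1 / card (seqs T)\<close>. A union bound over \<open>Y\<close> finishes.\<close>

lemma prob_draws_le: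
  assumes a0: "a0 \<in> profiles n m" and Y: "Y \<subseteq> seqs T"
    and fresh: "\<And>y. y \<in> Y \<Longrightarrow> inj_on (visit a0 y) {..<T}"
    and A: "A \<subseteq> {U \<in> space payoffs. restrict (draws U a0) {..<T} \<in> Y}"
  shows "measure payoffs A \<le> card Y / card (seqs T)"
proof -
  have finY: "finite Y" using Y finite_seqs finite_subset by blast
  define C where "C y = visit a0 y ` {..<T}" for y
  \<comment> \<open>The table assigns to a cell the action drawn at its only visit; freshness makes
    that visit unique.\<close>
  define v where "v y = (\<lambda>c\<in>C y. y (the_inv_into {..<T} (visit a0 y) c))" for y
  define E where "E y = {U \<in> space payoffs. \<forall>c\<in>C y. best_resp m U (fst c) (snd c) = v y c}" for y
  have v_visit: "v y (visit a0 y t) = y t" if "y \<in> Y" "t < T" for y t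
    using that the_inv_into_f_f[OF fresh] by (simp add: v_def C_def)
  have fst_visit: "fst (visit a0 y t) = mover t" for y t
    by (simp add: visit_def cell_def)
  have y_in: "y t \<in> {1..m (mover t)}" if "y \<in> Y" "t < T" for y t
    using that Y by (auto simp: seqs_def PiE_iff)
  have E_le: "measure payoffs (E y) \<le> 1 / card (seqs T)" if y: "y \<in> Y" for y
  proof -
    have "C y \<subseteq> cells"
      unfolding C_def using y_in[OF y] by (auto intro!: visit_in_cells[OF a0])
    moreover have "v y \<in> PiE (C y) (\<lambda>c. {1..m (fst c)})"
    proof (rule PiE_I)
      fix c assume "c \<in> C y"
      then obtain t where "t < T" "c = visit a0 y t" by (auto simp: C_def)
      then show "v y c \<in> {1..m (fst c)}"
        using v_visit[OF y] y_in[OF y] fst_visit by metis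
    qed (simp add: v_def)
    ultimately have "measure payoffs (E y) \<le> 1 / (\<Prod>c\<in>C y. real (m (fst c)))"
      unfolding E_def by (rule prob_best_resp_le)
    also have "(\<Prod>c\<in>C y. real (m (fst c))) = card (seqs T)"
      unfolding C_def card_seqs using fst_visit by (subst prod.reindex[OF fresh[OF y]]) simp
    finally show ?thesis .
  qed
  have finC: "finite (C y)" for y by (simp add: C_def)
  have E_sets: "E y \<in> sets payoffs" for y
    unfolding E_def using finC by measurable
  have "{U \<in> space payoffs. restrict (draws U a0) {..<T} \<in> Y} \<subseteq> (\<Union>y\<in>Y. E y)"
  proof
    fix U assume U: "U \<in> {U \<in> space payoffs. restrict (draws U a0) {..<T} \<in> Y}"
    define y where "y = restrict (draws U a0) {..<T}"
    have y: "y \<in> Y" using U y_def by simp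
    have "best_resp m U (fst (visit a0 y t)) (snd (visit a0 y t)) = y t" if t: "t < T" for t
    proof -
      have "play a0 y t = clock_dyn n m U a0 t"
        unfolding clock_dyn_eq_play using t by (intro play_cong) (simp add: y_def)
      then show ?thesis using t by (simp add: visit_def cell_def y_def draws_def)
    qed
    then have "U \<in> E y" using U v_visit[OF y] by (auto simp: E_def C_def)
    then show "U \<in> (\<Union>y\<in>Y. E y)" using y by blast
  qed
  then have "measure payoffs A \<le> measure payoffs (\<Union>y\<in>Y. E y)"
    using A finY E_sets by (intro payoffs.finite_measure_mono) auto
  also have "\<dots> \<le> (\<Sum>y\<in>Y. measure payoffs (E y))"
    using finY E_sets by (intro payoffs.finite_measure_subadditive_finite) auto
  also have "\<dots> \<le> (\<Sum>y\<in>Y. 1 / card (seqs T))"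
    using E_le by (rule sum_mono)
  finally show ?thesis by simp
qed

section \<open>Absorption, periodicity and freshness before the first PNE\<close>

lemma clock_dyn_PNE_absorbing:
  assumes "is_PNE n m U (clock_dyn n m U a0 s)"
  shows "clock_dyn n m U a0 (s + u) = clock_dyn n m U a0 s"
proof (induction u)
  case (Suc u)
  have "clock_dyn n m U a0 s (mover (s + u)) = best_resp m U (mover (s + u)) (clock_dyn n m U a0 s)"
    using assms mover_in by (simp only: is_PNE_def)
  then show ?case using Suc by (simp add: Let_def fun_upd_idem)
qed simp

text \<open>After a repeated cell the profiles agree, and the steps agree modulo \<open>n\<close>,
  so both continuations have the same movers and best responses.\<close>

lemma clock_dyn_periodic:
  assumes "cell (mover s) (clock_dyn n m U a0 s) = cell (mover t) (clock_dyn n m U a0 t)"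
  shows "clock_dyn n m U a0 (Suc s + u) = clock_dyn n m U a0 (Suc t + u)"
proof (induction u)
  case 0
  show ?case using best_resp_cell_eq(2)[OF assms] by (simp add: Let_def)
next
  case (Suc u)
  have "s mod n = t mod n"
    using assms by (simp add: cell_def mover_eq_iff[symmetric])
  then have "(Suc s + u) mod n = (Suc t + u) mod n" by (metis mod_add_cong mod_Suc_eq)
  then have "mover (Suc s + u) = mover (Suc t + u)" by (simp only: mover_eq_iff)
  then show ?case using Suc by (simp only: add_Suc_right clock_dyn.simps Let_def)
qed

text \<open>A repetition at \<open>r < s\<close> has \<open>r + n \<le> s\<close>, so periodicity
  carries a PNE back by at least \<open>n\<close> steps, to a positive time before
  \<open>t\<close>.\<close>

lemma first_PNE_fresh:
  assumes t: "1 \<le> t" "is_PNE n m U (clock_dyn n m U a0 t)"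
    and first: "\<And>s. 1 \<le> s \<Longrightarrow> s < t \<Longrightarrow> \<not> is_PNE n m U (clock_dyn n m U a0 s)"
  shows "inj_on (visit a0 (draws U a0)) {..<t + n - 1}"
proof (rule linorder_inj_onI)
  fix r s assume rs: "r < s" "r \<in> {..<t + n - 1}" "s \<in> {..<t + n - 1}"
  show "visit a0 (draws U a0) r \<noteq> visit a0 (draws U a0) s"
  proof
    assume eq: "visit a0 (draws U a0) r = visit a0 (draws U a0) s"
    then have c: "cell (mover r) (clock_dyn n m U a0 r) = cell (mover s) (clock_dyn n m U a0 s)"
      by (simp add: visit_def clock_dyn_eq_play)
    then have "mover r = mover s" by (simp add: cell_def)
    then have le: "r + n \<le> s" using rs mover_eq_imp_le by blast
    \<comment> \<open>Truncated subtraction: \<open>Suc s + u\<close> is the larger of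
      \<open>t\<close> and \<open>Suc s\<close>. If it is \<open>Suc s\<close>, the shifted time
      \<open>Suc r\<close> is still below \<open>t\<close> because
      \<open>s < t + n - 1\<close>.\<close>
    define u where "u = t - Suc s"
    have "clock_dyn n m U a0 (Suc s + u) = clock_dyn n m U a0 t"
      using clock_dyn_PNE_absorbing[OF t(2), of "Suc s + u - t"] by (simp add: u_def)
    then have "is_PNE n m U (clock_dyn n m U a0 (Suc r + u))"
      using clock_dyn_periodic[OF c, of u] t(2) by simp
    moreover have "Suc r + u < t" using rs le n_ge by (auto simp: u_def)
    ultimately show False using first[of "Suc r + u"] by simp
  qed
qed auto

definition first_PNE :: "(nat \<Rightarrow> nat) \<Rightarrow> nat \<Rightarrow> (nat \<times> (nat \<Rightarrow> nat) \<Rightarrow> real) set" where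
  "first_PNE a0 t = {U \<in> space payoffs. is_PNE n m U (clock_dyn n m U a0 t) \<and>
     (\<forall>s\<in>{1..<t}. \<not> is_PNE n m U (clock_dyn n m U a0 s))}"

section \<open>Measurability of the dynamic\<close>

text \<open>For fixed \<open>a0\<close> and \<open>t\<close>, a finite range independent of
  \<open>U\<close> turns events about the trajectory into finite unions over profiles.\<close>

lemma clock_dyn_finite_range: "\<exists>S. finite S \<and> (\<forall>U. clock_dyn n m U a0 t \<in> S)"
proof (induction t)
  case (Suc t)
  then obtain S where S: "finite S" "\<And>U. clock_dyn n m U a0 t \<in> S" by blast
  let ?S = "(\<lambda>(A, x). A(mover t := x)) ` (S \<times> {1..m (mover t)})"
  have "clock_dyn n m U a0 (Suc t) \<in> ?S" for U
    using S(2)[of U] best_resp_in[of m, OF mover_m_pos, of U t "clock_dyn n m U a0 t"]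
    unfolding clock_dyn.simps Let_def by (intro image_eqI[where x = "(_, _)"]) auto
  then show ?case using S(1) by (intro exI[of _ ?S]) auto
qed auto

lemma pred_clock_dyn [measurable]: "Measurable.pred payoffs (\<lambda>U. clock_dyn n m U a0 t = a)"
proof (induction t arbitrary: a)
  case (Suc t)
  note [measurable] = Suc
  obtain S where S: "finite S" "\<And>U. clock_dyn n m U a0 t \<in> S"
    using clock_dyn_finite_range by blast
  have "(clock_dyn n m U a0 (Suc t) = a) \<longleftrightarrow> (\<exists>A\<in>S. clock_dyn n m U a0 t = A \<and>
     best_resp m U (mover t) A = a (mover t) \<and> A(mover t := a (mover t)) = a)" for U
    using S(2)[of U] by (auto simp: Let_def)
  then show ?case using S(1) by (simp only:) measurable
qed simp

lemma pred_is_PNE_clock_dyn [measurable]: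
  "Measurable.pred payoffs (\<lambda>U. is_PNE n m U (clock_dyn n m U a0 t))"
proof -
  obtain S where S: "finite S" "\<And>U. clock_dyn n m U a0 t \<in> S"
    using clock_dyn_finite_range by blast
  have "is_PNE n m U (clock_dyn n m U a0 t) \<longleftrightarrow> (\<exists>A\<in>S. clock_dyn n m U a0 t = A \<and>
     A \<in> profiles n m \<and> (\<forall>i\<in>{1..n}. best_resp m U i A = A i))" for U
    using S(2)[of U] by (auto simp: is_PNE_def)
  then show ?thesis using S(1) by (simp only:) measurable
qed

lemma sets_first_PNE: "first_PNE a0 t \<in> sets payoffs"
  unfolding first_PNE_def by measurable

section \<open>Probability that the first PNE occurs at a given time\<close>

abbreviation q :: real where "q \<equiv> q_nm n m"

lemma q_pos: "0 < q"
proof -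
  have "Max (m ` {1..n}) \<in> m ` {1..n}" using n_ge by (intro Max_in) auto
  then have "0 < Max (m ` {1..n})" using m_pos by (auto simp: Suc_le_eq)
  moreover have "0 < (\<Prod>i\<in>{1..n}. real (m i))"
    using m_pos by (intro prod_pos) (auto simp: Suc_le_eq)
  ultimately show ?thesis by (simp add: q_nm_def)
qed

text \<open>One more step would complete a round, so exactly one player is left out, with at most
  the maximal number of actions.\<close>

lemma q_le_prod: "q \<le> (\<Prod>s\<in>{t..<t + n - 1}. real (m (mover s)))"
proof -
  have M: "m (mover s) \<le> Max (m ` {1..n})" for s
    using mover_in by (intro Max_ge) auto
  have "{t..<t + n} = insert (t + n - 1) {t..<t + n - 1}" using n_ge by auto
  then have "(\<Prod>i\<in>{1..n}. real (m i)) =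
      real (m (mover (t + n - 1))) * (\<Prod>s\<in>{t..<t + n - 1}. real (m (mover s)))"
    using prod_mover[of "\<lambda>i. real (m i)" t] by simp
  also have "\<dots> \<le> real (Max (m ` {1..n})) * (\<Prod>s\<in>{t..<t + n - 1}. real (m (mover s)))"
    using M by (intro mult_right_mono prod_nonneg) auto
  finally show ?thesis
    using M[of 0] mover_m_pos[of 0] by (simp add: q_nm_def divide_le_eq mult.commute)
qed

text \<open>From a PNE on, the movers repeat their current actions, so the first \<open>t\<close>
  draws determine the next \<open>n - 1\<close>. The window stops there because step
  \<open>t + n - 1\<close> revisits the cell of step \<open>t - 1\<close>.\<close>

lemma prob_first_PNE_le:
  assumes a0: "a0 \<in> profiles n m" and t: "1 \<le> t"
  shows "measure payoffs (first_PNE a0 t) \<le> 1 / q"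
proof -
  let ?T = "t + n - 1"
  define Y where "Y = {y \<in> seqs ?T. inj_on (visit a0 y) {..<?T} \<and>
     (\<forall>s\<in>{t..<?T}. y s = play a0 y t (mover s))}"
  have tT: "t \<le> ?T" using n_ge by simp
  have "first_PNE a0 t \<subseteq> {U \<in> space payoffs. restrict (draws U a0) {..<?T} \<in> Y}"
  proof
    fix U assume U: "U \<in> first_PNE a0 t"
    define y where "y = restrict (draws U a0) {..<?T}"
    have vis: "visit a0 y s = visit a0 (draws U a0) s" if "s < ?T" for s
      using that by (intro visit_cong) (simp add: y_def)
    have "inj_on (visit a0 (draws U a0)) {..<?T}"
      using U t by (intro first_PNE_fresh) (auto simp: first_PNE_def)
    then have "inj_on (visit a0 y) {..<?T}"
      using vis by (subst inj_on_cong[of _ _ "visit a0 (draws U a0)"]) auto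
    moreover have "y \<in> seqs ?T" using draws_in by (auto simp: seqs_def y_def)
    moreover have "y s = play a0 y t (mover s)" if s: "s \<in> {t..<?T}" for s
    proof -
      have PNE: "is_PNE n m U (clock_dyn n m U a0 t)" using U by (simp add: first_PNE_def)
      have "y s = best_resp m U (mover s) (clock_dyn n m U a0 s)"
        using s by (simp add: y_def draws_def)
      also have "clock_dyn n m U a0 s = clock_dyn n m U a0 t"
        using clock_dyn_PNE_absorbing[OF PNE, of "s - t"] s by simp
      also have "best_resp m U (mover s) (clock_dyn n m U a0 t) = clock_dyn n m U a0 t (mover s)"
        using PNE mover_in by (simp only: is_PNE_def)
      also have "clock_dyn n m U a0 t = play a0 y t"
        unfolding clock_dyn_eq_play using tT by (intro play_cong) (simp add: y_def)
      finally show ?thesis .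
    qed
    ultimately have "y \<in> Y" by (simp add: Y_def)
    then show "U \<in> {U \<in> space payoffs. restrict (draws U a0) {..<?T} \<in> Y}"
      using U by (simp add: y_def first_PNE_def)
  qed
  then have "measure payoffs (first_PNE a0 t) \<le> card Y / card (seqs ?T)"
    by (intro prob_draws_le[OF a0]) (auto simp: Y_def)
  also have "\<dots> \<le> card (seqs t) / card (seqs ?T)"
  proof -
    have "inj_on (\<lambda>y. restrict y {..<t}) Y"
    proof (rule inj_onI)
      fix x y assume xy: "x \<in> Y" "y \<in> Y" "restrict x {..<t} = restrict y {..<t}"
      then have eq: "x s = y s" if "s < t" for s using that by (metis lessThan_iff restrict_apply')
      then have "play a0 x t = play a0 y t" by (rule play_cong)
      then have "x s = y s" if "s < ?T" for s
        using that eq xy(1,2) by (cases "s < t") (auto simp: Y_def)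
      then show "x = y" using xy(1,2) unfolding Y_def seqs_def by (auto intro: PiE_ext)
    qed
    moreover have "(\<lambda>y. restrict y {..<t}) ` Y \<subseteq> seqs t"
      using restrict_in_seqs[OF _ tT] by (auto simp: Y_def)
    ultimately have "card Y \<le> card (seqs t)" using finite_seqs by (rule card_inj_on_le)
    then show ?thesis by (simp add: divide_right_mono)
  qed
  also have "\<dots> = 1 / (\<Prod>s\<in>{t..<?T}. real (m (mover s)))"
  proof -
    have "{..<?T} = {..<t} \<union> {t..<?T}" using tT by auto
    then have "real (card (seqs ?T)) = real (card (seqs t)) * (\<Prod>s\<in>{t..<?T}. real (m (mover s)))"
      unfolding card_seqs by (simp add: prod.union_disjoint ivl_disj_int)
    then show ?thesis using card_seqs_pos[of t] by simp
  qed
  also have "\<dots> \<le> 1 / q" using q_le_prod q_pos by (intro divide_left_mono mult_pos_pos) (auto intro: less_le_trans)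
  finally show ?thesis .
qed

section \<open>The birthday bound for the environments of one player\<close>

definition visit_time :: "nat \<Rightarrow> nat \<Rightarrow> nat" where
  "visit_time i r = i - 1 + r * n"

text \<open>Visits 0 to \<open>r\<close> are compared, that is \<open>r + 1\<close> cells; the last
  is already fixed by the draws before \<open>visit_time i r\<close>, hence the length of the
  sequences.\<close>

definition distinct_seqs :: "(nat \<Rightarrow> nat) \<Rightarrow> nat \<Rightarrow> nat \<Rightarrow> (nat \<Rightarrow> nat) set" where
  "distinct_seqs a0 i r =
     {y \<in> seqs (visit_time i r). inj_on (\<lambda>j. visit a0 y (visit_time i j)) {..r}}"

lemma mover_visit_time: "i \<in> {1..n} \<Longrightarrow> mover (visit_time i r) = i"
proof -
  assume i: "i \<in> {1..n}"
  have "(i - 1 + r * n) mod n = i - 1" using i by (subst mod_mult_self1) auto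
  then show ?thesis using i by (simp only: clockwork_def visit_time_def diff_Suc_1) auto
qed

lemma visit_time_Suc: "visit_time i (Suc r) = visit_time i r + n"
  by (simp add: visit_time_def)

lemma visit_time_mono: "j \<le> r \<Longrightarrow> visit_time i j \<le> visit_time i r"
  by (simp add: visit_time_def)

lemma visit_time_le: "i \<in> {1..n} \<Longrightarrow> visit_time i k \<le> n * (k + 1)"
  by (auto simp: visit_time_def algebra_simps)

lemma inj_visit_time: "inj (visit_time i)"
  using n_ge by (auto simp: visit_time_def inj_def)

lemma card_seqs_add: "card (seqs (t + n)) = card (seqs t) * card (profiles n m)"
proof -
  have "{..<t + n} = {..<t} \<union> {t..<t + n}" by auto
  then have "card (seqs (t + n)) = card (seqs t) * (\<Prod>s\<in>{t..<t + n}. m (mover s))"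
    unfolding card_seqs by (simp add: prod.union_disjoint ivl_disj_int)
  then show ?thesis by (simp only: prod_mover card_profiles)
qed

text \<open>Filling in the action of \<open>i\<close> gives \<open>m i\<close> profiles over each
  cell of \<open>S\<close>, and these fibres are disjoint.\<close>

lemma card_profiles_avoiding:
  assumes i: "i \<in> {1..n}" and S: "S \<subseteq> cell i ` profiles n m"
  shows "real (card {a \<in> profiles n m. cell i a \<notin> S}) \<le>
    real (card (profiles n m)) - real (m i) * real (card S)"
proof -
  have eS: "j = i \<and> e i = 0 \<and> cell i e = (j, e) \<and> (\<forall>x\<in>{1..m i}. e(i := x) \<in> profiles n m)"
    if "(j, e) \<in> S" for j e
    using that S fun_upd_in_profiles[OF _ i] by (auto simp: cell_def)
  let ?f = "\<lambda>((j, e), x). e(i := x)"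
  have "inj_on ?f (S \<times> {1..m i})"
  proof (rule inj_onI, clarify)
    fix j e x j' e' x'
    assume *: "(j, e) \<in> S" "(j', e') \<in> S" "e(i := x) = e'(i := x')"
    have "e(i := 0) = e'(i := 0)" using arg_cong[OF *(3), of "\<lambda>f. f(i := 0)"] by simp
    moreover have "e(i := 0) = e" "e'(i := 0) = e'" using eS *(1,2) by (metis fun_upd_triv)+
    moreover have "x = x'" using fun_cong[OF *(3), of i] by simp
    moreover have "j = j'" using eS *(1,2) by blast
    ultimately show "((j, e) = (j', e')) \<and> x = x'" by simp
  qed
  moreover have "?f ` (S \<times> {1..m i}) \<subseteq> {a \<in> profiles n m. cell i a \<in> S}"
  proof clarify
    fix j e x assume *: "(j, e) \<in> S" "x \<in> {1..m i}"
    then have "e(i := x) \<in> profiles n m" "cell i (e(i := x)) = (j, e)"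
      using eS[OF *(1)] by simp_all
    then show "e(i := x) \<in> profiles n m \<and> cell i (e(i := x)) \<in> S" using *(1) by simp
  qed
  moreover have "finite {a \<in> profiles n m. cell i a \<in> S}" by simp
  ultimately have "card (S \<times> {1..m i}) \<le> card {a \<in> profiles n m. cell i a \<in> S}"
    by (rule card_inj_on_le)
  then have "real (m i) * real (card S) \<le> card {a \<in> profiles n m. cell i a \<in> S}"
    by (simp add: card_cartesian_product mult.commute flip: of_nat_mult)
  moreover have "card (profiles n m) =
      card {a \<in> profiles n m. cell i a \<in> S} + card {a \<in> profiles n m. cell i a \<notin> S}"
    by (subst card_Un_disjoint[symmetric]) (auto intro: arg_cong[where f = card])
  ultimately show ?thesis by simp
qed

text \<open>The \<open>n\<close> draws between two consecutive visits of player \<open>i\<close> correspond bijectively to the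
  profile at the second visit.\<close>
lemma card_distinct_seqs_Suc:
  assumes a0: "a0 \<in> profiles n m" and i: "i \<in> {1..n}"
  shows "real (card (distinct_seqs a0 i (Suc r))) \<le>
    real (card (distinct_seqs a0 i r)) * (real (card (profiles n m)) - real (m i) * real (Suc r))"
proof -
  let ?t = "visit_time i r"
  let ?B = "\<lambda>z. (\<lambda>j. visit a0 z (visit_time i j)) ` {..r}"
  \<comment> \<open>Pairs of an earlier distinct sequence and a next profile whose cell is new;
    \<open>?f\<close> embeds the longer sequences into them.\<close>
  let ?G = "SIGMA z : distinct_seqs a0 i r. {a \<in> profiles n m. cell i a \<notin> ?B z}"
  let ?f = "\<lambda>y. (restrict y {..<?t}, play a0 y (?t + n))"
  have fin: "finite (distinct_seqs a0 i r)"
    unfolding distinct_seqs_def using finite_seqs by simp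
  have "inj_on ?f (distinct_seqs a0 i (Suc r))"
  proof (rule inj_onI)
    fix x y assume x: "x \<in> distinct_seqs a0 i (Suc r)" and y: "y \<in> distinct_seqs a0 i (Suc r)"
      and eq: "?f x = ?f y"
    have "x s = y s" if s: "s < ?t + n" for s
    proof (cases "s < ?t")
      case True
      then show ?thesis using eq by (metis lessThan_iff prod.inject restrict_apply')
    next
      case False
      \<comment> \<open>The last \<open>n\<close> draws are read off the profile at time
        \<open>?t + n\<close>.\<close>
      then have "play a0 x (?t + n) (mover s) = x s" "play a0 y (?t + n) (mover s) = y s"
        using s by (intro play_last_draw; simp)+
      then show ?thesis using eq by simp
    qed
    then show "x = y"
      using x y unfolding distinct_seqs_def seqs_def visit_time_Suc by (auto intro: PiE_ext)
  qed
  moreover have "?f ` distinct_seqs a0 i (Suc r) \<subseteq> ?G"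
  proof (rule image_subsetI, intro SigmaI CollectI conjI)
    fix y assume y: "y \<in> distinct_seqs a0 i (Suc r)"
    let ?z = "restrict y {..<?t}"
    have ys: "y \<in> seqs (?t + n)"
      and inj: "inj_on (\<lambda>j. visit a0 y (visit_time i j)) {..Suc r}"
      using y by (auto simp: distinct_seqs_def visit_time_Suc)
    have vis: "visit a0 ?z (visit_time i j) = visit a0 y (visit_time i j)" if "j \<le> r" for j
      using visit_time_mono[OF that, of i] by (intro visit_cong) auto
    have "inj_on (\<lambda>j. visit a0 y (visit_time i j)) {..r}"
      using inj by (rule inj_on_subset) auto
    then have "inj_on (\<lambda>j. visit a0 ?z (visit_time i j)) {..r}"
      using vis by (subst inj_on_cong[of _ _ "\<lambda>j. visit a0 y (visit_time i j)"]) auto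
    then show "?z \<in> distinct_seqs a0 i r"
      using restrict_in_seqs[OF ys, of ?t] by (simp add: distinct_seqs_def)
    show "play a0 y (?t + n) \<in> profiles n m"
      using ys by (intro play_in_profiles[OF a0]) (auto simp: seqs_def PiE_iff)
    show "cell i (play a0 y (?t + n)) \<notin> ?B ?z"
    proof
      assume "cell i (play a0 y (?t + n)) \<in> ?B ?z"
      moreover have "visit a0 y (visit_time i (Suc r)) = cell i (play a0 y (?t + n))"
        using mover_visit_time[OF i, of "Suc r"] by (simp only: visit_def visit_time_Suc)
      ultimately obtain j where "j \<le> r"
        "visit a0 y (visit_time i (Suc r)) = visit a0 y (visit_time i j)"
        using vis by auto
      then show False using inj_onD[OF inj, of "Suc r" j] by simp
    qed
  qed
  moreover have "finite ?G" using fin by simp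
  ultimately have "card (distinct_seqs a0 i (Suc r)) \<le> card ?G" by (rule card_inj_on_le)
  also have "card ?G = (\<Sum>z\<in>distinct_seqs a0 i r. card {a \<in> profiles n m. cell i a \<notin> ?B z})"
    using fin by (subst card_SigmaI) auto
  finally have "real (card (distinct_seqs a0 i (Suc r))) \<le>
      (\<Sum>z\<in>distinct_seqs a0 i r. real (card {a \<in> profiles n m. cell i a \<notin> ?B z}))"
    by (simp flip: of_nat_sum)
  also have "\<dots> \<le> (\<Sum>z\<in>distinct_seqs a0 i r.
      real (card (profiles n m)) - real (m i) * real (Suc r))"
  proof (rule sum_mono)
    fix z assume z: "z \<in> distinct_seqs a0 i r"
    have "card (?B z) = Suc r"
      using z by (subst card_image) (auto simp: distinct_seqs_def)
    moreover have "?B z \<subseteq> cell i ` profiles n m"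
    proof (rule image_subsetI)
      fix j assume "j \<in> {..r}"
      then have "play a0 z (visit_time i j) \<in> profiles n m"
        using z visit_time_mono[of j r i]
        by (intro play_in_profiles[OF a0]) (auto simp: distinct_seqs_def seqs_def PiE_iff)
      then show "visit a0 z (visit_time i j) \<in> cell i ` profiles n m"
        by (simp add: visit_def mover_visit_time[OF i])
    qed
    ultimately show "real (card {a \<in> profiles n m. cell i a \<notin> ?B z}) \<le>
        real (card (profiles n m)) - real (m i) * real (Suc r)"
      using card_profiles_avoiding[OF i, of "?B z"] by simp
  qed
  finally show ?thesis by simp
qed

text \<open>Each further round multiplies the proportion of distinct sequences by at most
  \<open>1 - (k + 1) / q \<le> exp (- (k + 1) / q)\<close>. A player with the most actions is taken
  since it has exactly \<open>q\<close> environments.\<close>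

lemma card_distinct_seqs_le:
  assumes a0: "a0 \<in> profiles n m" and i: "i \<in> {1..n}" "m i = Max (m ` {1..n})"
  shows "real (card (distinct_seqs a0 i k)) \<le>
    real (card (seqs (visit_time i k))) * exp (- (\<Sum>r\<le>k. real r) / q)"
proof (induction k)
  case 0
  have "card (distinct_seqs a0 i 0) \<le> card (seqs (visit_time i 0))"
    using finite_seqs by (intro card_mono) (auto simp: distinct_seqs_def)
  then show ?case by simp
next
  case (Suc k)
  let ?M = "real (card (profiles n m))"
  have "real (m i) > 0" using m_pos[OF i(1)] by simp
  then have qM: "real (m i) * real (Suc k) = ?M * (real (Suc k) / q)"
  proof -
    have "real (m i) * q = ?M"
      using \<open>real (m i) > 0\<close> unfolding q_nm_def card_profiles i(2)[symmetric] by simp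
    then show ?thesis using q_pos by (simp add: field_simps)
  qed
  have "?M - real (m i) * real (Suc k) = ?M * (1 + - (real (Suc k) / q))"
    unfolding qM by (simp add: algebra_simps)
  also have "\<dots> \<le> ?M * exp (- (real (Suc k) / q))"
    by (intro mult_left_mono exp_ge_add_one_self) auto
  finally have "real (card (distinct_seqs a0 i (Suc k))) \<le>
      real (card (distinct_seqs a0 i k)) * (?M * exp (- (real (Suc k) / q)))"
    using card_distinct_seqs_Suc[OF a0 i(1), of k]
    by (meson mult_left_mono of_nat_0_le_iff order_trans)
  also have "\<dots> \<le> (real (card (seqs (visit_time i k))) * exp (- (\<Sum>r\<le>k. real r) / q)) *
      (?M * exp (- (real (Suc k) / q)))"
    using Suc by (intro mult_right_mono) auto
  also have "\<dots> = (real (card (seqs (visit_time i k))) * ?M) *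
      exp (- (\<Sum>r\<le>k. real r) / q + - (real (Suc k) / q))"
    unfolding exp_add by (simp only: mult_ac)
  also have "- (\<Sum>r\<le>k. real r) / q + - (real (Suc k) / q) = - (\<Sum>r\<le>Suc k. real r) / q"
    using q_pos by (simp add: field_simps)
  also have "real (card (seqs (visit_time i k))) * ?M = real (card (seqs (visit_time i (Suc k))))"
    by (simp only: visit_time_Suc card_seqs_add of_nat_mult)
  finally show ?case .
qed

section \<open>Convergence from a fixed initial profile\<close>

lemma pred_converges_PNE [measurable]: "Measurable.pred payoffs (\<lambda>U. converges_PNE n m U a0)"
  unfolding converges_PNE_def by measurable

text \<open>Split at the time \<open>T\<close> of visit \<open>k\<close>: a first PNE before
  \<open>T\<close> is handled by a union bound over times, a later one forces the birthday
  event.\<close>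

lemma prob_converges_le:
  assumes a0: "a0 \<in> profiles n m"
  shows "measure payoffs {U \<in> space payoffs. converges_PNE n m U a0} \<le>
    real n * (real k + 1) / q + exp (- (real k)\<^sup>2 / (2 * q))"
proof -
  have "Max (m ` {1..n}) \<in> m ` {1..n}" using n_ge by (intro Max_in) auto
  then obtain i where i: "i \<in> {1..n}" "m i = Max (m ` {1..n})" by auto
  define T where "T = visit_time i k"
  define E where "E = {U \<in> space payoffs. converges_PNE n m U a0}"
  define F where "F = (\<Union>t\<in>{1..<T}. first_PNE a0 t)"
  \<comment> \<open>Distinct visits of \<open>i\<close> bound the count; freshness of all cells
    before \<open>T\<close> permits the comparison with uniform draws.\<close>
  define Y where "Y = {y \<in> distinct_seqs a0 i k. inj_on (visit a0 y) {..<T}}"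
  have [measurable]: "E \<in> sets payoffs" "F \<in> sets payoffs"
    unfolding E_def F_def using sets_first_PNE by auto
  have "E - F \<subseteq> {U \<in> space payoffs. restrict (draws U a0) {..<T} \<in> Y}"
  proof
    fix U assume U: "U \<in> E - F"
    have sp: "U \<in> space payoffs" and conv: "\<exists>t. 1 \<le> t \<and> is_PNE n m U (clock_dyn n m U a0 t)"
      using U by (auto simp: E_def converges_PNE_def)
    let ?P = "\<lambda>t. 1 \<le> t \<and> is_PNE n m U (clock_dyn n m U a0 t)"
    define t where "t = (LEAST t. ?P t)"
    have t: "?P t" unfolding t_def using conv by (rule LeastI_ex)
    have first: "\<not> is_PNE n m U (clock_dyn n m U a0 s)" if "1 \<le> s" "s < t" for s
      using that not_less_Least[of s ?P] by (auto simp: t_def)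
    have "U \<in> first_PNE a0 t" using t first sp by (auto simp: first_PNE_def)
    then have "T \<le> t" using U t by (force simp: F_def)
    \<comment> \<open>Step \<open>T\<close> itself is included, as \<open>distinct_seqs\<close>
      needs: \<open>T \<le> t\<close> and \<open>2 \<le> n\<close> give
      \<open>T < t + n - 1\<close>.\<close>
    have inj: "inj_on (visit a0 (draws U a0)) {..T}"
      using first_PNE_fresh[OF conjunct1[OF t] conjunct2[OF t] first]
      by (rule inj_on_subset) (use \<open>T \<le> t\<close> n_ge in auto)
    define y where "y = restrict (draws U a0) {..<T}"
    have vis: "visit a0 y s = visit a0 (draws U a0) s" if "s \<le> T" for s
      using that by (intro visit_cong) (simp add: y_def)
    have injT: "inj_on (visit a0 y) {..T}"
      using inj vis by (subst inj_on_cong[of _ _ "visit a0 (draws U a0)"]) auto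
    have "inj_on (visit a0 y \<circ> visit_time i) {..k}"
    proof (rule comp_inj_on)
      show "inj_on (visit_time i) {..k}" using inj_visit_time by (rule inj_on_subset) simp
      show "inj_on (visit a0 y) (visit_time i ` {..k})"
        using injT by (rule inj_on_subset) (auto simp: T_def intro: visit_time_mono)
    qed
    moreover have "y \<in> seqs T" using draws_in by (auto simp: seqs_def y_def)
    moreover have "inj_on (visit a0 y) {..<T}" using injT by (rule inj_on_subset) auto
    ultimately have "y \<in> Y" by (simp add: Y_def distinct_seqs_def T_def comp_def)
    then show "U \<in> {U \<in> space payoffs. restrict (draws U a0) {..<T} \<in> Y}"
      using sp by (simp add: y_def)
  qed
  then have "measure payoffs (E - F) \<le> card Y / card (seqs T)"
    by (intro prob_draws_le[OF a0]) (auto simp: Y_def distinct_seqs_def T_def)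
  also have "\<dots> \<le> exp (- (\<Sum>r\<le>k. real r) / q)"
  proof -
    have "card Y \<le> card (distinct_seqs a0 i k)"
      unfolding Y_def distinct_seqs_def using finite_seqs by (intro card_mono) auto
    then have "real (card Y) \<le> real (card (seqs T)) * exp (- (\<Sum>r\<le>k. real r) / q)"
      using card_distinct_seqs_le[OF a0 i, of k] unfolding T_def by linarith
    then show ?thesis using card_seqs_pos[of T] by (simp add: divide_le_eq mult.commute)
  qed
  also have "\<dots> \<le> exp (- (real k)\<^sup>2 / (2 * q))"
  proof -
    have "(real k)\<^sup>2 / 2 \<le> (\<Sum>r\<le>k. real r)"
      by (induction k) (auto simp: power2_eq_square field_simps)
    then show ?thesis using q_pos by (simp add: field_simps)
  qed
  finally have late: "measure payoffs (E - F) \<le> exp (- (real k)\<^sup>2 / (2 * q))" .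
  have "measure payoffs F \<le> (\<Sum>t\<in>{1..<T}. measure payoffs (first_PNE a0 t))"
    unfolding F_def using sets_first_PNE
    by (intro payoffs.finite_measure_subadditive_finite) auto
  also have "\<dots> \<le> (\<Sum>t\<in>{1..<T}. 1 / q)"
    using prob_first_PNE_le[OF a0] by (intro sum_mono) auto
  also have "\<dots> = real (T - 1) / q" by simp
  also have "\<dots> \<le> real (n * (k + 1)) / q"
    using visit_time_le[OF i(1), of k] q_pos unfolding T_def
    by (intro divide_right_mono) (auto simp del: of_nat_mult of_nat_add)
  finally have early: "measure payoffs F \<le> real n * (real k + 1) / q"
    by (simp add: algebra_simps)
  have "measure payoffs E \<le> measure payoffs (F \<union> (E - F))"
    by (intro payoffs.finite_measure_mono) auto
  also have "\<dots> \<le> measure payoffs F + measure payoffs (E - F)"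
    by (intro measure_Un_le) auto
  finally show ?thesis using early late unfolding E_def by linarith
qed

section \<open>Averaging over the initial profile and choice of the number of rounds\<close>

lemma clock_dyn_outside: "j \<notin> {1..n} \<Longrightarrow> clock_dyn n m U a0 t j = a0 j"
  using mover_in by (induction t) (auto simp: Let_def)

text \<open>Coordinates outside the players never change, and every PNE is extensional.\<close>

lemma converges_PNE_extensional:
  "converges_PNE n m U a0 \<Longrightarrow> a0 \<in> PiE {1..n} (\<lambda>_. UNIV)"
  using clock_dyn_outside[of _ U a0]
  by (force simp: converges_PNE_def is_PNE_def profiles_def PiE_iff extensional_def)

text \<open>The initial profile ranges over an uncountable type with the discrete sigma-algebra; only
  countably many initial values can lead to a PNE.\<close>
lemma sets_conv_event: "conv_event n m D \<in> sets (game_space n m D)"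
proof -
  let ?X = "PiE {1..n} (\<lambda>_. UNIV) :: (nat \<Rightarrow> nat) set"
  have "conv_event n m D =
      (\<Union>a0\<in>?X. {U \<in> space payoffs. converges_PNE n m U a0} \<times> {a0})"
    unfolding conv_event_def game_space_def space_pair_measure
    using converges_PNE_extensional by auto
  moreover have "countable ?X" by (intro countable_PiE) auto
  ultimately show ?thesis unfolding game_space_def
    by (auto intro!: sets.countable_UN' pair_measureI)
qed

lemma measure_conv_event_le:
  "measure (game_space n m D) (conv_event n m D) \<le>
    real n * (real k + 1) / q + exp (- (real k)\<^sup>2 / (2 * q))" (is "_ \<le> ?b")
proof -
  let ?N = "measure_pmf (pmf_of_set (profiles n m))"
  interpret P: pair_prob_space payoffs ?N ..
  have b: "0 \<le> ?b" using q_pos by simp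
  \<comment> \<open>A witness that \<open>profiles n m\<close> is nonempty, so that
    \<open>pmf_of_set\<close> has the intended support.\<close>
  have "(\<lambda>i\<in>{1..n}. 1) \<in> profiles n m" using m_pos by (auto simp: profiles_def)
  then have "set_pmf (pmf_of_set (profiles n m)) = profiles n m"
    by (intro set_pmf_of_set) auto
  then have supp: "AE a0 in ?N. a0 \<in> profiles n m"
    by (simp add: AE_measure_pmf_iff)
  have "emeasure (game_space n m D) (conv_event n m D) =
      (\<integral>\<^sup>+ a0. emeasure payoffs ((\<lambda>U. (U, a0)) -` conv_event n m D) \<partial>?N)"
    using sets_conv_event unfolding game_space_def by (rule P.emeasure_pair_measure_alt2)
  also have "\<dots> \<le> (\<integral>\<^sup>+ a0. ennreal ?b \<partial>?N)"
    using supp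
  proof (intro nn_integral_mono_AE, eventually_elim)
    fix a0 assume a0: "a0 \<in> profiles n m"
    have "(\<lambda>U. (U, a0)) -` conv_event n m D = {U \<in> space payoffs. converges_PNE n m U a0}"
      by (auto simp: conv_event_def game_space_def space_pair_measure)
    then show "emeasure payoffs ((\<lambda>U. (U, a0)) -` conv_event n m D) \<le> ennreal ?b"
      using prob_converges_le[OF a0, of k] by (simp add: payoffs.emeasure_eq_measure ennreal_leI)
  qed
  also have "\<dots> = ennreal ?b" by simp
  finally show ?thesis unfolding measure_def using b by (simp add: enn2real_leI)
qed

text \<open>\<open>q\<close> is the product over all players but a maximal one. This controls
  \<open>n\<close> by \<open>q\<close>, making the final bound uniform in \<open>n\<close>.\<close>

lemma two_power_le_q: "2 ^ (n - 1) \<le> q"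
proof -
  have "Max (m ` {1..n}) \<in> m ` {1..n}" using n_ge by (intro Max_in) auto
  then obtain i where i: "i \<in> {1..n}" "m i = Max (m ` {1..n})" by auto
  have "(2::real) ^ (n - 1) = (\<Prod>j\<in>{1..n} - {i}. 2)" using i(1) by simp
  also have "\<dots> \<le> (\<Prod>j\<in>{1..n} - {i}. real (m j))"
  proof (intro prod_mono conjI)
    fix j assume "j \<in> {1..n} - {i}"
    then have "2 \<le> m j" using m_ge by blast
    then show "2 \<le> real (m j)" by simp
  qed simp
  also have "\<dots> = q"
    using m_pos[OF i(1)] prod.remove[of "{1..n}" i "\<lambda>j. real (m j)"] i by (simp add: q_nm_def)
  finally show ?thesis .
qed

lemma measure_conv_event_le_q:
  "measure (game_space n m D) (conv_event n m D) \<le>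
    (1 + log 2 q) * (q powr (2/3) + 2) / q + exp (- (q powr (1/3)) / 2)"
proof -
  \<comment> \<open>The exponent 2/3 lies between 1/2, so that \<open>k\<^sup>2 / q\<close>
    diverges, and 1, so that \<open>n * k / q\<close> vanishes despite the logarithmic
    \<open>n\<close>.\<close>
  define k where "k = nat \<lceil>q powr (2/3)\<rceil>"
  have k: "q powr (2/3) \<le> real k" "real k \<le> q powr (2/3) + 1"
    unfolding k_def using powr_ge_zero[of q "2/3"] by linarith+
  have "real (n - 1) = log 2 (2 ^ (n - 1))" by simp
  also have "\<dots> \<le> log 2 q" using two_power_le_q q_pos by (subst log_le_cancel_iff) auto
  finally have n: "real n \<le> 1 + log 2 q" using n_ge by simp
  have "real n * (real k + 1) \<le> (1 + log 2 q) * (q powr (2/3) + 2)"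
    using n k by (intro mult_mono) auto
  then have "real n * (real k + 1) / q \<le> (1 + log 2 q) * (q powr (2/3) + 2) / q"
    using q_pos by (intro divide_right_mono) auto
  moreover have "q powr (1/3) / 2 \<le> (real k)\<^sup>2 / (2 * q)"
  proof -
    have "q powr (1/3) * q = q powr (1/3) * q powr 1" using q_pos by simp
    also have "\<dots> = (q powr (2/3))\<^sup>2"
      unfolding power2_eq_square powr_add[symmetric] by simp
    also have "\<dots> \<le> (real k)\<^sup>2" using k by (intro power_mono) auto
    finally show ?thesis using q_pos by (simp add: field_simps)
  qed
  ultimately show ?thesis using measure_conv_event_le[of k] by (smt (verit) exp_le_cancel_iff minus_divide_left)
qed

end

theorem theorem1:
  fixes D :: "real measure" and \<epsilon> :: real
  assumes "prob_space D" and "sets D = sets borel"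
    and "\<forall>x. emeasure D {x} = 0"
    and "\<epsilon> > 0"
  shows "\<exists>Q::real. \<forall>n::nat. \<forall>m::nat \<Rightarrow> nat.
           n \<ge> 2 \<longrightarrow> (\<forall>i\<in>{1..n}. m i \<ge> 2) \<longrightarrow> q_nm n m \<ge> Q \<longrightarrow>
           conv_event n m D \<in> sets (game_space n m D) \<and>
           measure (game_space n m D) (conv_event n m D) < \<epsilon>"
proof -
  let ?f = "\<lambda>q::real. (1 + log 2 q) * (q powr (2/3) + 2) / q + exp (- (q powr (1/3)) / 2)"
  \<comment> \<open>The bound depends on \<open>n\<close> and \<open>m\<close> only through
    \<open>q\<close>, so a limit in one real variable gives a uniform \<open>Q\<close>.\<close>
  have "(?f \<longlongrightarrow> 0) at_top" by real_asymp
  then have "eventually (\<lambda>q. ?f q < \<epsilon>) at_top"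
    using \<open>\<epsilon> > 0\<close> by (rule order_tendstoD)
  then obtain Q where Q: "\<And>q. q \<ge> Q \<Longrightarrow> ?f q < \<epsilon>"
    unfolding eventually_at_top_linorder by blast
  show ?thesis
  proof (intro exI[of _ Q] allI impI)
    fix n :: nat and m :: "nat \<Rightarrow> nat"
    assume "n \<ge> 2" "\<forall>i\<in>{1..n}. m i \<ge> 2" and q: "q_nm n m \<ge> Q"
    then interpret random_game n m D
      using assms by (intro random_game.intro) auto
    show "conv_event n m D \<in> sets (game_space n m D) \<and>
        measure (game_space n m D) (conv_event n m D) < \<epsilon>"
      using sets_conv_event measure_conv_event_le_q Q[OF q] by linarith
  qed
qed

end
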